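(* Let $j,k$ be positive integers, suppose $\mathbf{B}_j^k$ is finite and let $a_{j,k} = \max(\mathbf{B}_j^k)$. If $a_{j,k} < j(2^k-1)$, then $\{ n-(j+1) : n \in \mathbf{B}_{j+1}^k,\ n > j+1\} = \{ n-j : n \in \mathbf{B}_j^k,\ n > j\}.$
   Context: For positive integers $j,k$, a positive integer $n$ is called $(j,k)$-representable if $n = x_1^k + \cdots + x_j^k$ with all $x_i$ positive integers. $\mathbf{B}_j^k$ denotes the set of positive integers that are not $(j,k)$-representable. *)

theory Defs
  imports Main
begin

definition representable :: "nat \<Rightarrow> nat \<Rightarrow> nat \<Rightarrow> bool" where
  "representable j k n \<longleftrightarrow>
     n > 0 \<and> (\<exists>x :: nat \<Rightarrow> nat. (\<forall>i\<in>{1..j}. x i > 0) \<and> n = (\<Sum>i=1..j. x i ^ k))"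

definition B :: "nat \<Rightarrow> nat \<Rightarrow> nat set" where
  "B j k = {n. n > 0 \<and> \<not> representable j k n}"

text \<open>The value \<open>0\<close> for empty \<open>B j k\<close> (which, for positive \<open>j\<close> and \<open>k\<close>, happens only
  if \<open>j = k = 1\<close>) is the convention for the maximum of an empty set of positive integers;
  the library's \<open>Max\<close> is unspecified there.\<close>

definition max_B :: "nat \<Rightarrow> nat \<Rightarrow> nat" where
  "max_B j k = (if B j k = {} then 0 else Max (B j k))"

end

theory Submission
  imports Defs
begin

text \<open>Adding or removing a summand \<open>1 = 1 ^ k\<close> relates the representations of \<open>m\<close> by \<open>j\<close> powers to
  those of \<open>m + 1\<close> by \<open>j + 1\<close> powers; a representation of \<open>m + 1\<close> without such a summand has
  \<open>m + 1 \<ge> (j + 1) * 2 ^ k\<close>, which is impossible for \<open>m \<in> B j k\<close> by the bound on the maximum.\<close>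

lemma representable_Suc:
  assumes "representable j k m"
  shows "representable (Suc j) k (Suc m)"
proof -
  obtain x where x: "\<And>i. i \<in> {1..j} \<Longrightarrow> x i > 0" "m = (\<Sum>i=1..j. x i ^ k)"
    using assms unfolding representable_def by blast
  let ?y = "x(Suc j := 1)"
  have "(\<Sum>i=1..Suc j. ?y i ^ k) = Suc m"
    using x(2) by simp
  moreover have "\<forall>i\<in>{1..Suc j}. ?y i > 0"
    using x(1) by auto
  ultimately show ?thesis
    unfolding representable_def by (metis zero_less_Suc)
qed

text \<open>The hypothesis \<open>m > 0\<close> rules out \<open>j = 0\<close> with
  \<open>x 1 = 1\<close>, where deleting the summand leaves the empty sum 0.\<close>

lemma representable_SucD:
  assumes "representable (Suc j) k (Suc m)" and "m > 0" and "Suc m < Suc j * 2 ^ k"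
  shows "representable j k m"
proof -
  obtain x where x: "\<And>i. i \<in> {1..Suc j} \<Longrightarrow> x i > 0" "Suc m = (\<Sum>i=1..Suc j. x i ^ k)"
    using assms(1) unfolding representable_def by blast
  have "\<exists>i\<in>{1..Suc j}. x i = 1"
  proof (rule ccontr)
    assume "\<not> ?thesis"
    then have "\<And>i. i \<in> {1..Suc j} \<Longrightarrow> 2 \<le> x i"
      using x(1) by (metis One_nat_def Suc_leI le_neq_implies_less numeral_2_eq_2)
    then have "of_nat (card {1..Suc j}) * 2 ^ k \<le> (\<Sum>i=1..Suc j. x i ^ k)"
      by (intro sum_bounded_below power_mono) auto
    then show False
      using x(2) assms(3) by simp
  qed
  then obtain i where i: "i \<in> {1..Suc j}" "x i = 1" by blast
  \<comment> \<open>The summand 1 may sit at any index; moving the last base into its place keeps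
    the index set \<open>{1..j}\<close>.\<close>
  let ?y = "x(i := x (Suc j))"
  have "m = (\<Sum>l=1..j. ?y l ^ k)"
  proof (cases "i = Suc j")
    case True
    then show ?thesis using x(2) i(2) by simp
  next
    case False
    then have ij: "i \<in> {1..j}" using i(1) by auto
    have "(\<Sum>l=1..j. ?y l ^ k) = x (Suc j) ^ k + (\<Sum>l\<in>{1..j} - {i}. x l ^ k)"
      using ij by (simp add: sum.remove)
    moreover have "(\<Sum>l=1..j. x l ^ k) = 1 + (\<Sum>l\<in>{1..j} - {i}. x l ^ k)"
      using ij i(2) by (simp add: sum.remove)
    ultimately show ?thesis using x(2) by simp
  qed
  moreover have "\<forall>l\<in>{1..j}. ?y l > 0"
    using x(1) by auto
  ultimately show ?thesis
    using assms(2) unfolding representable_def by blast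
qed

lemma le_max_B: "finite (B j k) \<Longrightarrow> n \<in> B j k \<Longrightarrow> n \<le> max_B j k"
  unfolding max_B_def by auto

theorem theorem10p12:
  fixes j k :: nat
  assumes "j > 0" and "k > 0"
    and "finite (B j k)"
    and "max_B j k < j * (2 ^ k - 1)"
  shows "{n - (j + 1) | n. n \<in> B (j + 1) k \<and> n > j + 1} = {n - j | n. n \<in> B j k \<and> n > j}"
proof -
  have Suc_in_B: "Suc n \<in> B (Suc j) k \<longleftrightarrow> n \<in> B j k" if "n > j" for n
  proof
    assume "Suc n \<in> B (Suc j) k"
    \<comment> \<open>Here \<open>n > j\<close> supplies the positivity of \<open>n\<close> that
      membership in \<open>B j k\<close> demands.\<close>
    then show "n \<in> B j k"
      using representable_Suc that unfolding B_def by auto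
  next
    assume n: "n \<in> B j k"
    have "n < j * (2 ^ k - 1)"
      using le_max_B[OF assms(3) n] assms(4) by simp
    \<comment> \<open>The further summand \<open>2 ^ k\<close> in \<open>Suc j * 2 ^ k\<close>
      absorbs the increase from \<open>n\<close> to \<open>Suc n\<close>.\<close>
    also have "\<dots> \<le> j * 2 ^ k" by simp
    finally have "Suc n < Suc j * 2 ^ k"
      using one_le_power[of "2::nat" k] unfolding mult_Suc by linarith
    then show "Suc n \<in> B (Suc j) k"
      using n representable_SucD unfolding B_def by auto
  qed
  show ?thesis
  proof (intro equalityI subsetI)
    fix m assume "m \<in> {n - (j + 1) | n. n \<in> B (j + 1) k \<and> n > j + 1}"
    then obtain n where "m = n - Suc j" "n \<in> B (Suc j) k" "n > Suc j" by auto
    \<comment> \<open>Since \<open>n > Suc j\<close>, the truncated \<open>n - 1\<close> is a true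
      predecessor exceeding \<open>j\<close>, and \<open>n - Suc j = (n - 1) - j\<close>.\<close>
    then show "m \<in> {n - j | n. n \<in> B j k \<and> n > j}"
      using Suc_in_B[of "n - 1"] by (intro CollectI exI[of _ "n - 1"]) auto
  next
    fix m assume "m \<in> {n - j | n. n \<in> B j k \<and> n > j}"
    then obtain n where "m = n - j" "n \<in> B j k" "n > j" by auto
    then show "m \<in> {n - (j + 1) | n. n \<in> B (j + 1) k \<and> n > j + 1}"
      using Suc_in_B[of n] by (intro CollectI exI[of _ "Suc n"]) auto
  qed
qed

end
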